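(* For all integers $n\ge 2$, $$\mathrm{off}(n,2)=\theta(n,2)=\cos\frac{\pi}{n}.$$
   Context: For integers $n,d\ge1$: $\theta(n,d)$ denotes the minimum $\epsilon\ge 0$ such that there exists a real $n\times n$ Gram matrix (equivalently, symmetric positive semidefinite matrix) $B$ of rank at most $d$ with $B_{ii}=1$ for all $i$ and $|B_{ij}|\le\epsilon$ for all $i\neq j$. $\mathrm{off}(n,d)$ denotes the minimum $\epsilon\ge 0$ such that there exists a real $n\times n$ matrix $B$ (not necessarily symmetric) of rank at most $d$ with $B_{ii}=1$ for all $i$ and $|B_{ij}|\le\epsilon$ for all $i\neq j$. *)

theory Defs
  imports Complex_Main "Jordan_Normal_Form.DL_Rank"
begin

definition pos_semidef :: "real mat \<Rightarrow> bool" where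
  "pos_semidef B \<longleftrightarrow> square_mat B \<and> transpose_mat B = B \<and>
     (\<forall>v \<in> carrier_vec (dim_row B). 0 \<le> v \<bullet> (B *\<^sub>v v))"

definition unit_diag_offdiag_le :: "nat \<Rightarrow> nat \<Rightarrow> real \<Rightarrow> real mat \<Rightarrow> bool" where
  "unit_diag_offdiag_le n d \<epsilon> B \<longleftrightarrow>
     B \<in> carrier_mat n n \<and> vec_space.rank n B \<le> d \<and>
     (\<forall>i<n. B $$ (i, i) = 1) \<and>
     (\<forall>i<n. \<forall>j<n. i \<noteq> j \<longrightarrow> \<bar>B $$ (i, j)\<bar> \<le> \<epsilon>)"

(* LEAST (rather than an infimum) denotes a minimum: its value is determined only if
   the minimum is attained. *)

definition theta :: "nat \<Rightarrow> nat \<Rightarrow> real" where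
  "theta n d = (LEAST \<epsilon>. 0 \<le> \<epsilon> \<and> (\<exists>B. unit_diag_offdiag_le n d \<epsilon> B \<and> pos_semidef B))"

definition off :: "nat \<Rightarrow> nat \<Rightarrow> real" where
  "off n d = (LEAST \<epsilon>. 0 \<le> \<epsilon> \<and> (\<exists>B. unit_diag_offdiag_le n d \<epsilon> B))"

end

theory Submission
  imports Defs
begin

text \<open>
  The value \<open>cos (pi / n)\<close> is attained by the Gram matrix of \<open>n\<close> unit vectors spanning equally
  spaced lines in the plane, with entries \<open>cos ((i - j) pi / n)\<close>.

  For the lower bound, a matrix of rank at most two has entries \<open>B\<^sub>i\<^sub>j = p\<^sub>i \<bullet> q\<^sub>j\<close> with planar
  vectors \<open>p\<^sub>i\<close> and \<open>q\<^sub>j\<close> (\<open>rank_factorization\<close>). Let \<open>\<epsilon> < 1\<close> bound the off-diagonal entries.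
  Then no two of the \<open>p\<^sub>i\<close> are parallel, so after changing signs
  and permuting they have increasing angles within a half-turn. Extend them to a sequence with
  \<open>p\<^bsub>i+n\<^esub> = - p\<^sub>i\<close>, and let \<open>D i j\<close> be the determinant of \<open>p\<^sub>i\<close> and \<open>p\<^sub>j\<close>. Pairing the identity
  \<open>D i (i+2) p\<^bsub>i+1\<^esub> = D (i+1) (i+2) p\<^sub>i + D i (i+1) p\<^bsub>i+2\<^esub>\<close> with \<open>q\<^bsub>i+1\<^esub>\<close> gives
  \<open>D i (i+2) \<le> \<epsilon> (D i (i+1) + D (i+1) (i+2))\<close>.

  Divided by \<open>D i (i+1) D (i+1) (i+2)\<close>, that identity says that both coordinates of \<open>p\<close> solve
  the Sturm--Liouville recurrence \<open>c\<^sub>i g\<^bsub>i+1\<^esub> = w\<^sub>i g\<^sub>i + w\<^bsub>i+1\<^esub> g\<^bsub>i+2\<^esub>\<close> with \<open>w\<^sub>i = 1 / D i (i+1)\<close> and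
  \<open>c\<^sub>i = D i (i+2) w\<^sub>i w\<^bsub>i+1\<^esub>\<close>, and the inequality becomes \<open>c\<^sub>i \<le> \<epsilon> (w\<^sub>i + w\<^bsub>i+1\<^esub>)\<close>. Since \<open>p\<close> turns by only
  a half-turn in \<open>n\<close> steps, the quadratic form \<open>\<Sum>i<n. c\<^sub>i f\<^bsub>i+1\<^esub>\<^sup>2 - 2 w\<^sub>i f\<^sub>i f\<^bsub>i+1\<^esub>\<close> is nonnegative on
  antiperiodic sequences \<open>f\<close> (\<open>antiperiodic_form_nonneg\<close>). Adding its values at
  \<open>f\<^sub>i = cos (i pi / n)\<close> and \<open>f\<^sub>i = sin (i pi / n)\<close> yields
  \<open>0 \<le> \<Sum>i<n. c\<^sub>i - 2 w\<^sub>i cos (pi / n) \<le> 2 (\<epsilon> - cos (pi / n)) (\<Sum>i<n. w\<^sub>i)\<close>,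
  and the last sum is positive.
\<close>

section \<open>A discrete Sturm comparison\<close>

lemma sum_shift_periodic:
  fixes F :: "nat \<Rightarrow> real"
  assumes "F n = F 0"
  shows "(\<Sum>i<n. F (Suc i)) = (\<Sum>i<n. F i)"
  using sum.lessThan_Suc_shift[of F n] sum.lessThan_Suc[of F n] assms by simp

text \<open>
  Picone's identity: if the recurrence has a solution \<open>s\<close> that vanishes at \<open>0\<close> and \<open>n\<close> and is
  positive in between, the form is, up to a telescoping sum, a sum of squares of differences of
  \<open>h / s\<close>. At both ends the quotients are \<open>0 / 0 = 0\<close>.
\<close>

lemma picone_dirichlet:
  fixes c w s h :: "nat \<Rightarrow> real"
  assumes rec: "\<And>i. c i * s (Suc i) = w i * s i + w (Suc i) * s (Suc (Suc i))"
    and w: "\<And>i. 0 < w i"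
    and s: "\<And>i. 0 < i \<Longrightarrow> i < n \<Longrightarrow> 0 < s i" "s 0 = 0" "s n = 0"
    and h: "h 0 = 0" "h n = 0"
  shows "0 \<le> (\<Sum>i<n. c i * (h (Suc i))\<^sup>2 - 2 * w i * h i * h (Suc i))"
proof -
  define T where "T i = w i * s (Suc i) * (h i)\<^sup>2 / s i" for i
  have "c i * (h (Suc i))\<^sup>2 - 2 * w i * h i * h (Suc i)
      = w i * s i * s (Suc i) * (h i / s i - h (Suc i) / s (Suc i))\<^sup>2 + (T (Suc i) - T i)"
    if "i < n" for i
  proof -
    consider "i = 0" "Suc i = n" | "i = 0" "Suc i < n" | "0 < i" "Suc i = n" | "0 < i" "Suc i < n"
      using \<open>i < n\<close> by linarith
    then show ?thesis
    proof cases
      case 1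
      then show ?thesis using h by (simp add: T_def)
    next
      case 2
      then have s1: "s (Suc 0) > 0" using s(1)[of 1] by simp
      have "c 0 * s (Suc 0) = w (Suc 0) * s (Suc (Suc 0))" using rec[of 0] s(2) by simp
      then have "c 0 = w (Suc 0) * s (Suc (Suc 0)) / s (Suc 0)" using s1 by (simp add: field_simps)
      then show ?thesis using 2 s1 h s(2) by (simp add: T_def)
    next
      case 3
      then have "s i > 0" using s(1) by simp
      then show ?thesis using 3 h s(3) by (simp add: T_def)
    next
      case 4
      then have p: "s i > 0" "s (Suc i) > 0" using s(1) by simp_all
      then have c: "c i = (w i * s i + w (Suc i) * s (Suc (Suc i))) / s (Suc i)"
        using rec[of i] by (simp add: field_simps)
      show ?thesis using p unfolding c T_def
        by (simp add: field_simps power2_eq_square)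
    qed
  qed
  then have "(\<Sum>i<n. c i * (h (Suc i))\<^sup>2 - 2 * w i * h i * h (Suc i))
      = (\<Sum>i<n. w i * s i * s (Suc i) * (h i / s i - h (Suc i) / s (Suc i))\<^sup>2) + (T n - T 0)"
    by (simp add: sum.distrib sum_lessThan_telescope)
  moreover have "T n - T 0 = 0" using h by (simp add: T_def)
  moreover have "0 \<le> s i" if "i \<le> n" for i
    using that s by (cases "i = 0 \<or> i = n") (auto simp: less_imp_le)
  then have "0 \<le> (\<Sum>i<n. w i * s i * s (Suc i) * (h i / s i - h (Suc i) / s (Suc i))\<^sup>2)"
    using w by (intro sum_nonneg mult_nonneg_nonneg) (auto simp: less_imp_le)
  ultimately show ?thesis by simp
qed

text \<open>Antiperiodic solutions \<open>g\<close> of the recurrence lie in the kernel of the form.\<close>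

lemma form_minus_solution:
  fixes c w f g :: "nat \<Rightarrow> real"
  assumes rec: "\<And>i. c i * g (Suc i) = w i * g i + w (Suc i) * g (Suc (Suc i))"
    and anti: "\<And>i. f (i + n) = - f i" "\<And>i. g (i + n) = - g i"
    and w: "\<And>i. w (i + n) = w i"
  shows "(\<Sum>i<n. c i * (f (Suc i))\<^sup>2 - 2 * w i * f i * f (Suc i))
       = (\<Sum>i<n. c i * (f (Suc i) - g (Suc i))\<^sup>2 - 2 * w i * (f i - g i) * (f (Suc i) - g (Suc i)))"
proof -
  \<comment> \<open>The difference of the two forms is the polar form at \<open>2 * f - g\<close> and \<open>g\<close>.\<close>
  define G where "G i = w i * (2 * f i - g i) * g (Suc i)" for i
  have "c i * (f (Suc i))\<^sup>2 - 2 * w i * f i * f (Suc i)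
      = c i * (f (Suc i) - g (Suc i))\<^sup>2 - 2 * w i * (f i - g i) * (f (Suc i) - g (Suc i))
        + (G (Suc i) - G i)" for i
  proof -
    have "c i * (f (Suc i))\<^sup>2 = c i * (f (Suc i) - g (Suc i))\<^sup>2
        + (2 * f (Suc i) - g (Suc i)) * (c i * g (Suc i))"
      by (simp add: power2_eq_square algebra_simps)
    then show ?thesis unfolding G_def rec by (simp add: algebra_simps)
  qed
  moreover have "G n = G 0" using anti(1)[of 0] anti(2)[of 0] anti(2)[of 1] w[of 0]
    by (simp add: G_def algebra_simps)
  ultimately show ?thesis by (simp add: sum.distrib sum_lessThan_telescope)
qed

text \<open>The determinant of the planar vectors \<open>(a i, b i)\<close> and \<open>(a j, b j)\<close>.\<close>

definition cross :: "(nat \<Rightarrow> real) \<Rightarrow> (nat \<Rightarrow> real) \<Rightarrow> nat \<Rightarrow> nat \<Rightarrow> real" where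
  "cross a b i j = a i * b j - a j * b i"

text \<open>
  The hypotheses say that the points \<open>(a i, b i)\<close> turn counterclockwise, reaching the
  opposite of the initial point after \<open>n\<close> steps and not before.
\<close>

lemma antiperiodic_form_nonneg:
  fixes a b f :: "nat \<Rightarrow> real"
  defines "w \<equiv> \<lambda>i. 1 / cross a b i (Suc i)"
  defines "c \<equiv> \<lambda>i. cross a b i (Suc (Suc i)) * w i * w (Suc i)"
  assumes anti: "\<And>i. a (i + n) = - a i" "\<And>i. b (i + n) = - b i" "\<And>i. f (i + n) = - f i"
    and pos: "\<And>i. 0 < cross a b i (Suc i)"
    and pos0: "\<And>i. 0 < i \<Longrightarrow> i < n \<Longrightarrow> 0 < cross a b 0 i"
  shows "0 \<le> (\<Sum>i<n. c i * (f (Suc i))\<^sup>2 - 2 * w i * f i * f (Suc i))"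
proof -
  \<comment> \<open>Subtracting the solution \<open>g\<close>, which agrees with \<open>f\<close> at \<open>0\<close>, leaves a sequence vanishing
    at \<open>0\<close> and \<open>n\<close>; the solution \<open>s\<close> is the positive one for Picone's identity.\<close>
  define g where "g i = f 0 / cross a b 0 1 * cross a b i 1" for i
  define h where "h i = f i - g i" for i
  define s where "s i = cross a b 0 i" for i
  have w0: "0 < w i" for i using pos by (simp add: w_def)
  have wper: "w (i + n) = w i" for i
    using anti(1)[of i] anti(1)[of "Suc i"] anti(2)[of i] anti(2)[of "Suc i"]
    by (simp add: w_def cross_def)
  have rec: "c i * (x * a (Suc i) + y * b (Suc i))
     = w i * (x * a i + y * b i) + w (Suc i) * (x * a (Suc (Suc i)) + y * b (Suc (Suc i)))"
    for x y i
  proof -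
    have id: "cross a b i (Suc (Suc i)) * (x * a (Suc i) + y * b (Suc i))
      = cross a b (Suc i) (Suc (Suc i)) * (x * a i + y * b i)
        + cross a b i (Suc i) * (x * a (Suc (Suc i)) + y * b (Suc (Suc i)))"
      by (simp add: cross_def algebra_simps)
    have "c i * (x * a (Suc i) + y * b (Suc i))
      = (cross a b i (Suc (Suc i)) * (x * a (Suc i) + y * b (Suc i))) * (w i * w (Suc i))"
      by (simp add: c_def)
    also have "\<dots> = w i * (x * a i + y * b i) + w (Suc i) * (x * a (Suc (Suc i)) + y * b (Suc (Suc i)))"
      unfolding id using pos[of i] pos[of "Suc i"] by (simp add: w_def field_simps)
    finally show ?thesis .
  qed
  have g: "g i = (f 0 / cross a b 0 1 * b 1) * a i + (- (f 0 / cross a b 0 1 * a 1)) * b i" for i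
    by (simp add: g_def cross_def algebra_simps diff_divide_distrib)
  have s: "s i = (- b 0) * a i + a 0 * b i" for i
    by (simp add: s_def cross_def)
  have grec: "c i * g (Suc i) = w i * g i + w (Suc i) * g (Suc (Suc i))" for i
    unfolding g by (rule rec)
  have srec: "c i * s (Suc i) = w i * s i + w (Suc i) * s (Suc (Suc i))" for i
    unfolding s by (rule rec)
  have ganti: "g (i + n) = - g i" for i unfolding g anti by (simp add: algebra_simps)
  have g0: "g 0 = f 0" using pos[of 0] by (simp add: g_def)
  have h: "h 0 = 0" "h n = 0"
    using g0 anti(3)[of 0] ganti[of 0] by (simp_all add: h_def)
  have sn: "s 0 = 0" "s n = 0"
    using anti(1)[of 0] anti(2)[of 0] by (simp_all add: s_def cross_def)
  have "0 \<le> (\<Sum>i<n. c i * (h (Suc i))\<^sup>2 - 2 * w i * h i * h (Suc i))"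
    by (rule picone_dirichlet[where s = s]) (use srec w0 pos0 sn h in \<open>auto simp: s_def\<close>)
  then show ?thesis
    unfolding form_minus_solution[of c g w f n, OF grec anti(3) ganti wper] h_def .
qed

lemma antiperiodic_lower_bound:
  fixes a b :: "nat \<Rightarrow> real"
  assumes n: "0 < n"
    and anti: "\<And>i. a (i + n) = - a i" "\<And>i. b (i + n) = - b i"
    and pos: "\<And>i. 0 < cross a b i (Suc i)"
    and pos0: "\<And>i. 0 < i \<Longrightarrow> i < n \<Longrightarrow> 0 < cross a b 0 i"
    and le: "\<And>i. cross a b i (Suc (Suc i))
               \<le> \<epsilon> * (cross a b i (Suc i) + cross a b (Suc i) (Suc (Suc i)))"
  shows "cos (pi / n) \<le> \<epsilon>"
proof -
  define \<theta> where "\<theta> = pi / n"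
  define w where "w i = 1 / cross a b i (Suc i)" for i
  define c where "c i = cross a b i (Suc (Suc i)) * w i * w (Suc i)" for i
  have nth: "real n * \<theta> = pi" using n by (simp add: \<theta>_def)
  have w0: "0 < w i" for i using pos by (simp add: w_def)
  have wper: "w n = w 0"
    using anti(1)[of 0] anti(1)[of 1] anti(2)[of 0] anti(2)[of 1]
    by (simp add: w_def cross_def)
  have C: "0 \<le> (\<Sum>i<n. c i * (cos (Suc i * \<theta>))\<^sup>2 - 2 * w i * cos (i * \<theta>) * cos (Suc i * \<theta>))"
    unfolding c_def w_def
    by (rule antiperiodic_form_nonneg[of a n b "\<lambda>i. cos (i * \<theta>)"])
      (use anti pos pos0 in \<open>auto simp: distrib_right nth\<close>)
  have S: "0 \<le> (\<Sum>i<n. c i * (sin (Suc i * \<theta>))\<^sup>2 - 2 * w i * sin (i * \<theta>) * sin (Suc i * \<theta>))"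
    unfolding c_def w_def
    by (rule antiperiodic_form_nonneg[of a n b "\<lambda>i. sin (i * \<theta>)"])
      (use anti pos pos0 in \<open>auto simp: distrib_right nth\<close>)
  have "c i * (cos (Suc i * \<theta>))\<^sup>2 - 2 * w i * cos (i * \<theta>) * cos (Suc i * \<theta>)
     + (c i * (sin (Suc i * \<theta>))\<^sup>2 - 2 * w i * sin (i * \<theta>) * sin (Suc i * \<theta>))
     = c i - 2 * w i * cos \<theta>" for i
  proof -
    have 1: "c i * (cos (Suc i * \<theta>))\<^sup>2 + c i * (sin (Suc i * \<theta>))\<^sup>2 = c i"
      by (metis distrib_left mult.right_neutral sin_cos_squared_add2)
    have "cos (Suc i * \<theta> - i * \<theta>) = cos \<theta>" by (simp add: algebra_simps)
    then have "cos (i * \<theta>) * cos (Suc i * \<theta>) + sin (i * \<theta>) * sin (Suc i * \<theta>) = cos \<theta>"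
      unfolding cos_diff by (simp add: mult.commute)
    then have "2 * w i * cos \<theta> = 2 * w i * cos (i * \<theta>) * cos (Suc i * \<theta>)
        + 2 * w i * sin (i * \<theta>) * sin (Suc i * \<theta>)"
      by (metis distrib_left mult.assoc)
    with 1 show ?thesis by linarith
  qed
  then have "0 \<le> (\<Sum>i<n. c i - 2 * w i * cos \<theta>)"
    using add_nonneg_nonneg[OF C S] by (simp only: sum.distrib[symmetric])
  also have "\<dots> \<le> (\<Sum>i<n. \<epsilon> * (w i + w (Suc i)) - 2 * w i * cos \<theta>)"
  proof (rule sum_mono)
    fix i
    have "c i \<le> \<epsilon> * (cross a b i (Suc i) + cross a b (Suc i) (Suc (Suc i))) * w i * w (Suc i)"
      unfolding c_def using le[of i] w0 by (intro mult_right_mono) (auto simp: less_imp_le)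
    also have "\<dots> = \<epsilon> * (w i + w (Suc i))"
      using pos[of i] pos[of "Suc i"] by (simp add: w_def field_simps)
    finally show "c i - 2 * w i * cos \<theta> \<le> \<epsilon> * (w i + w (Suc i)) - 2 * w i * cos \<theta>" by simp
  qed
  also have "\<dots> = (\<epsilon> * (\<Sum>i<n. w i) + \<epsilon> * (\<Sum>i<n. w (Suc i))) - 2 * cos \<theta> * (\<Sum>i<n. w i)"
    by (simp add: sum.distrib sum_subtractf sum_distrib_left algebra_simps)
  also have "\<dots> = 2 * (\<epsilon> - cos \<theta>) * (\<Sum>i<n. w i)"
    unfolding sum_shift_periodic[of w n, OF wper] by (simp add: algebra_simps)
  finally have "0 \<le> 2 * (\<epsilon> - cos \<theta>) * (\<Sum>i<n. w i)" .
  moreover have "0 < (\<Sum>i<n. w i)" using w0 n by (intro sum_pos) auto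
  ultimately have "0 \<le> 2 * (\<epsilon> - cos \<theta>)"
    unfolding zero_le_mult_iff by linarith
  then show ?thesis by (simp add: \<theta>_def)
qed

section \<open>Planar vectors in angular order\<close>

text \<open>
  The vectors \<open>(a i, b i)\<close>, ordered by angle within an open half-turn, and their dual vectors
  \<open>(c i, d i)\<close> are extended antiperiodically; the inequality between determinants needed for
  \<open>antiperiodic_lower_bound\<close> only uses the products at neighbouring indices.
\<close>

lemma ordered_lower_bound:
  fixes a b c d :: "nat \<Rightarrow> real"
  assumes n: "2 \<le> n"
    and pos: "\<And>i j. i < j \<Longrightarrow> j < n \<Longrightarrow> 0 < cross a b i j"
    and diag: "\<And>i. i < n \<Longrightarrow> a i * c i + b i * d i = 1"
    and off: "\<And>i j. i < n \<Longrightarrow> j < n \<Longrightarrow> i \<noteq> j \<Longrightarrow> \<bar>a i * c j + b i * d j\<bar> \<le> \<epsilon>"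
  shows "cos (pi / n) \<le> \<epsilon>"
proof -
  define ext where "ext u i = (- 1) ^ (i div n) * u (i mod n)" for u :: "nat \<Rightarrow> real" and i
  have ext_anti: "ext u (i + n) = - ext u i" for u i
    using n by (simp add: ext_def)
  have ext_lt: "ext u i = u i" if "i < n" for u i using that by (simp add: ext_def)
  have sgn: "\<bar>(- 1 :: real) ^ k\<bar> = 1" for k by (simp add: power_abs)
  have sgn2: "(- 1 :: real) ^ k * (- 1) ^ k = 1" for k by (simp flip: power_mult_distrib)
  have suc: "ext u (Suc i) = (- 1) ^ (i div n) *
      (if Suc (i mod n) = n then - u 0 else u (Suc (i mod n)))" for u i
    using n by (simp add: ext_def div_Suc mod_Suc)
  have cpos: "0 < cross (ext a) (ext b) i (Suc i)" for i
  proof -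
    have im: "i mod n < n" using n by simp
    have e: "ext u i = (- 1) ^ (i div n) * u (i mod n)" for u by (simp add: ext_def)
    have "cross (ext a) (ext b) i (Suc i) = ((- 1) ^ (i div n) * (- 1) ^ (i div n)) *
       (if Suc (i mod n) = n then cross a b 0 (i mod n) else cross a b (i mod n) (Suc (i mod n)))"
      unfolding cross_def suc e by (simp add: algebra_simps)
    moreover have "0 < i mod n" if "Suc (i mod n) = n" using that n by linarith
    ultimately show ?thesis
      using pos[of 0 "i mod n"] pos[of "i mod n" "Suc (i mod n)"] im by (auto simp: sgn2)
  qed
  have ediag: "ext a i * ext c i + ext b i * ext d i = 1" for i
  proof -
    have "ext a i * ext c i + ext b i * ext d i = ((- 1) ^ (i div n) * (- 1) ^ (i div n)) *
       (a (i mod n) * c (i mod n) + b (i mod n) * d (i mod n))"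
      by (simp add: ext_def algebra_simps)
    then show ?thesis using diag[of "i mod n"] n by (simp add: sgn2)
  qed
  have eoff: "ext a i * ext c j + ext b i * ext d j \<le> \<epsilon>" if "i mod n \<noteq> j mod n" for i j
  proof -
    have "ext a i * ext c j + ext b i * ext d j = ((- 1) ^ (i div n) * (- 1) ^ (j div n)) *
       (a (i mod n) * c (j mod n) + b (i mod n) * d (j mod n))"
      by (simp add: ext_def algebra_simps)
    then have "\<bar>ext a i * ext c j + ext b i * ext d j\<bar>
       = \<bar>a (i mod n) * c (j mod n) + b (i mod n) * d (j mod n)\<bar>"
      by (simp add: abs_mult sgn)
    then show ?thesis using off[of "i mod n" "j mod n"] that n by simp
  qed
  have ne: "i mod n \<noteq> Suc i mod n" for i using n by (auto simp: mod_Suc)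
  show ?thesis
  proof (rule antiperiodic_lower_bound[of n "ext a" "ext b"])
    fix i
    let ?p = "\<lambda>j. ext a j * ext c (Suc i) + ext b j * ext d (Suc i)"
    let ?D = "cross (ext a) (ext b)"
    have "?D i (Suc (Suc i)) = ?D i (Suc (Suc i)) * ?p (Suc i)" using ediag[of "Suc i"] by simp
    also have "\<dots> = ?D (Suc i) (Suc (Suc i)) * ?p i + ?D i (Suc i) * ?p (Suc (Suc i))"
      by (simp add: cross_def algebra_simps)
    also have "\<dots> \<le> ?D (Suc i) (Suc (Suc i)) * \<epsilon> + ?D i (Suc i) * \<epsilon>"
      using cpos ne[of i] ne[of "Suc i"]
      by (intro add_mono mult_left_mono eoff) (auto simp: less_imp_le)
    finally show "?D i (Suc (Suc i)) \<le> \<epsilon> * (?D i (Suc i) + ?D (Suc i) (Suc (Suc i)))"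
      by (simp add: algebra_simps)
  next
    fix i assume "0 < i" "i < n"
    then show "0 < cross (ext a) (ext b) 0 i"
      using pos[of 0 i] by (simp add: cross_def ext_lt)
  qed (use n ext_anti cpos in auto)
qed

text \<open>
  The angle is that of the line through \<open>(x, y)\<close>, and the sign of \<open>r\<close> tells on which side of
  the origin the point lies.
\<close>

lemma signed_polar:
  fixes x y :: real
  assumes "x \<noteq> 0 \<or> y \<noteq> 0"
  obtains r t where "r \<noteq> 0" "0 \<le> t" "t < pi" "x = r * cos t" "y = r * sin t"
proof -
  define z where "z = Complex x y"
  have z: "x = cmod z * cos (Arg z)" "y = cmod z * sin (Arg z)" "cmod z \<noteq> 0"
    using assms rcis_cmod_Arg[of z] by (auto simp: z_def rcis_def complex_eq_iff)
  have A: "- pi < Arg z" "Arg z \<le> pi" using Arg_bounded[of z] by auto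
  consider "Arg z < 0" | "0 \<le> Arg z" "Arg z < pi" | "Arg z = pi" using A by linarith
  then show ?thesis
  proof cases
    case 1
    then show ?thesis using that[of "- cmod z" "Arg z + pi"] z A by simp
  next
    case 2
    then show ?thesis using that[of "cmod z" "Arg z"] z by simp
  next
    case 3
    then show ?thesis using that[of "- cmod z" 0] z by simp
  qed
qed

lemma sorting_enumeration:
  fixes t :: "nat \<Rightarrow> real"
  assumes "inj_on t {..<n}"
  shows "\<exists>\<sigma>. (\<forall>i<n. \<sigma> i < n) \<and> (\<forall>i j. i < j \<longrightarrow> j < n \<longrightarrow> t (\<sigma> i) < t (\<sigma> j))"
proof -
  define xs where "xs = sort_key t [0..<n]"
  have xs: "set xs = {..<n}" "distinct xs" "length xs = n" "sorted (map t xs)"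
    by (auto simp: xs_def)
  have lt: "xs ! i < n" if "i < n" for i using xs that by (metis lessThan_iff nth_mem)
  have "t (xs ! i) < t (xs ! j)" if "i < j" "j < n" for i j
  proof -
    have "t (xs ! i) \<le> t (xs ! j)" using sorted_nth_mono[OF xs(4), of i j] that xs(3) by simp
    moreover have "xs ! i \<noteq> xs ! j" using that xs by (simp add: nth_eq_iff_index_eq)
    then have "t (xs ! i) \<noteq> t (xs ! j)"
      using assms lt that by (metis inj_onD lessThan_iff order_less_trans)
    ultimately show ?thesis by simp
  qed
  then show ?thesis using lt by (intro exI[of _ "\<lambda>i. xs ! i"]) blast
qed

lemma planar_lower_bound:
  fixes a b c d :: "nat \<Rightarrow> real"
  assumes n: "2 \<le> n"
    and diag: "\<And>i. i < n \<Longrightarrow> a i * c i + b i * d i = 1"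
    and off: "\<And>i j. i < n \<Longrightarrow> j < n \<Longrightarrow> i \<noteq> j \<Longrightarrow> \<bar>a i * c j + b i * d j\<bar> \<le> \<epsilon>"
  shows "cos (pi / n) \<le> \<epsilon>"
proof (cases "1 \<le> \<epsilon>")
  case True
  then show ?thesis using cos_le_one[of "pi / n"] by linarith
next
  case False
  have "\<exists>r t. r \<noteq> 0 \<and> 0 \<le> t \<and> t < pi \<and> a i = r * cos t \<and> b i = r * sin t" if "i < n" for i
  proof -
    have "a i \<noteq> 0 \<or> b i \<noteq> 0" using diag[OF that] by auto
    then show ?thesis by (rule signed_polar) blast
  qed
  then obtain r t where rt: "\<And>i. i < n \<Longrightarrow> r i \<noteq> 0" "\<And>i. i < n \<Longrightarrow> 0 \<le> t i" "\<And>i. i < n \<Longrightarrow> t i < pi"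
      "\<And>i. i < n \<Longrightarrow> a i = r i * cos (t i)" "\<And>i. i < n \<Longrightarrow> b i = r i * sin (t i)"
    by metis
  have "inj_on t {..<n}"
  proof (rule inj_onI, rule ccontr)
    fix i j assume "i \<in> {..<n}" "j \<in> {..<n}" and tij: "t i = t j" and "i \<noteq> j"
    then have ij: "i < n" "j < n" "i \<noteq> j" by auto
    \<comment> \<open>For parallel vectors the two mixed products multiply to \<open>1\<close>, so one of them has
      absolute value at least \<open>1\<close>.\<close>
    have "(a i * c j + b i * d j) * (a j * c i + b j * d i)
        = (a i * c i + b i * d i) * (a j * c j + b j * d j)"
      unfolding rt(4,5)[OF ij(1)] rt(4,5)[OF ij(2)] tij
      by (simp add: algebra_simps)
    then have "\<bar>a i * c j + b i * d j\<bar> * \<bar>a j * c i + b j * d i\<bar> = 1"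
      using diag ij by (simp flip: abs_mult)
    moreover have "\<bar>a i * c j + b i * d j\<bar> < 1" "\<bar>a j * c i + b j * d i\<bar> < 1"
      using off[of i j] off[of j i] ij False by auto
    ultimately show False
      by (metis abs_ge_zero less_irrefl mult_strict_mono' mult_1)
  qed
  then obtain \<sigma> where \<sigma>: "\<And>i. i < n \<Longrightarrow> \<sigma> i < n"
    "\<And>i j. i < j \<Longrightarrow> j < n \<Longrightarrow> t (\<sigma> i) < t (\<sigma> j)"
    using sorting_enumeration[of t n] by blast
  have ne: "\<sigma> i \<noteq> \<sigma> j" if "i < n" "j < n" "i \<noteq> j" for i j
    using \<sigma>(2)[of i j] \<sigma>(2)[of j i] that by (metis less_irrefl linorder_neqE_nat)
  \<comment> \<open>The sign \<open>\<eta> i\<close> moves the vector to the half-plane of angles in \<open>[0, pi)\<close>; applying it to the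
    dual vector as well preserves the diagonal products and the absolute values of the others.\<close>
  define \<eta> where "\<eta> i = sgn (r (\<sigma> i))" for i
  have \<eta>: "\<eta> i * \<eta> i = 1" "\<bar>\<eta> i\<bar> = 1" if "i < n" for i
    using rt(1)[OF \<sigma>(1)[OF that]] by (auto simp: \<eta>_def sgn_if)
  show ?thesis
  proof (rule ordered_lower_bound[of n "\<lambda>i. \<eta> i * a (\<sigma> i)" "\<lambda>i. \<eta> i * b (\<sigma> i)"
        "\<lambda>i. \<eta> i * c (\<sigma> i)" "\<lambda>i. \<eta> i * d (\<sigma> i)"])
    fix i j assume ij: "i < j" "j < n"
    then have l: "\<sigma> i < n" "\<sigma> j < n" using \<sigma>(1) by auto
    have "cross (\<lambda>i. \<eta> i * a (\<sigma> i)) (\<lambda>i. \<eta> i * b (\<sigma> i)) i j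
        = (\<eta> i * r (\<sigma> i)) * (\<eta> j * r (\<sigma> j)) * sin (t (\<sigma> j) - t (\<sigma> i))"
      unfolding cross_def rt(4,5)[OF l(1)] rt(4,5)[OF l(2)] sin_diff by (simp add: algebra_simps)
    also have "\<dots> = \<bar>r (\<sigma> i)\<bar> * \<bar>r (\<sigma> j)\<bar> * sin (t (\<sigma> j) - t (\<sigma> i))"
      by (simp add: \<eta>_def abs_sgn mult.commute)
    also have "\<dots> > 0"
      using rt(1)[OF l(1)] rt(1)[OF l(2)] \<sigma>(2)[OF ij] rt(2)[OF l(1)] rt(3)[OF l(2)]
      by (intro mult_pos_pos sin_gt_zero) auto
    finally show "0 < cross (\<lambda>i. \<eta> i * a (\<sigma> i)) (\<lambda>i. \<eta> i * b (\<sigma> i)) i j" .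
  next
    fix i assume i: "i < n"
    have "\<eta> i * a (\<sigma> i) * (\<eta> i * c (\<sigma> i)) + \<eta> i * b (\<sigma> i) * (\<eta> i * d (\<sigma> i))
       = (\<eta> i * \<eta> i) * (a (\<sigma> i) * c (\<sigma> i) + b (\<sigma> i) * d (\<sigma> i))"
      by (simp add: algebra_simps)
    then show "\<eta> i * a (\<sigma> i) * (\<eta> i * c (\<sigma> i)) + \<eta> i * b (\<sigma> i) * (\<eta> i * d (\<sigma> i)) = 1"
      using \<eta>(1)[OF i] diag[OF \<sigma>(1)[OF i]] by simp
  next
    fix i j assume ij: "i < n" "j < n" "i \<noteq> j"
    have "\<eta> i * a (\<sigma> i) * (\<eta> j * c (\<sigma> j)) + \<eta> i * b (\<sigma> i) * (\<eta> j * d (\<sigma> j))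
       = \<eta> i * \<eta> j * (a (\<sigma> i) * c (\<sigma> j) + b (\<sigma> i) * d (\<sigma> j))"
      by (simp add: algebra_simps)
    then show "\<bar>\<eta> i * a (\<sigma> i) * (\<eta> j * c (\<sigma> j)) + \<eta> i * b (\<sigma> i) * (\<eta> j * d (\<sigma> j))\<bar> \<le> \<epsilon>"
      using \<eta>(2)[OF ij(1)] \<eta>(2)[OF ij(2)] off[OF \<sigma>(1)[OF ij(1)] \<sigma>(1)[OF ij(2)] ne[OF ij]]
      by (simp add: abs_mult)
  qed (rule n)
qed

section \<open>Rank factorization\<close>

text \<open>
  The columns of the left factor are a maximal independent set \<open>S\<close> of columns of \<open>A\<close>, padded
  with zero columns.
\<close>

lemma (in vec_space) rank_factorization:
  assumes A: "A \<in> carrier_mat n nc" and rank: "rank A \<le> d"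
  shows "\<exists>f g. \<forall>i<n. \<forall>j<nc. A $$ (i, j) = (\<Sum>k<d. f i k * g k j)"
proof -
  let ?P = "\<lambda>T. T \<subseteq> set (cols A) \<and> lin_indpt T"
  have C: "set (cols A) \<subseteq> carrier_vec n" using A cols_dim by blast
  have "lin_indpt {}" by (metis empty_subsetI fin_dim finite_basis_exists subset_li_is_li vec_vs vectorspace.basis_def)
  then obtain S where S: "finite S" "maximal S ?P"
    using maximal_exists_superset[of "set (cols A)" ?P "{}"] by auto
  have SC: "S \<subseteq> set (cols A)" and li: "lin_indpt S" using S(2) by (auto simp: maximal_def)
  have SV: "S \<subseteq> carrier_vec n" using SC C by blast
  have card: "card S \<le> d" using rank_card_indpt[OF A S(2)] rank by simp
  have in_span: "v \<in> span S" if "v \<in> set (cols A)" for v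
  proof (rule ccontr)
    assume v: "v \<notin> span S"
    then have "v \<notin> S" using span_mem[OF SV] by blast
    have "lin_indpt (S \<union> {v})"
      using lin_dep_iff_in_span[of S v] SV li \<open>v \<notin> S\<close> v C that by auto
    then have "?P (S \<union> {v})" using SC that by blast
    then have "S \<union> {v} = S" using S(2) unfolding maximal_def by blast
    then show False using \<open>v \<notin> S\<close> by blast
  qed
  have "\<exists>u. \<forall>i<n. A $$ (i, j) = (\<Sum>x\<in>S. u x * x $ i)" if "j < nc" for j
  proof -
    have "col A j \<in> set (cols A)" using A that by (metis carrier_matD(2) cols_length cols_nth nth_mem)
    then have "col A j \<in> span S" by (rule in_span)
    then obtain u where u: "lincomb u S = col A j"
      using finite_in_span[of S "col A j"] S(1) SV by auto
    have "A $$ (i, j) = (\<Sum>x\<in>S. u x * x $ i)" if "i < n" for i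
      using lincomb_index[OF that SV, of u] u A \<open>j < nc\<close> that by (metis carrier_matD index_col)
    then show ?thesis by blast
  qed
  then obtain u where u: "\<And>i j. i < n \<Longrightarrow> j < nc \<Longrightarrow> A $$ (i, j) = (\<Sum>x\<in>S. u j x * x $ i)"
    by metis
  obtain e where e: "bij_betw e {..<card S} S"
    using S(1) by (metis ex_bij_betw_nat_finite lessThan_atLeast0)
  show ?thesis
  proof (rule exI[of _ "\<lambda>i k. if k < card S then e k $ i else 0"],
      rule exI[of _ "\<lambda>k j. u j (e k)"], intro allI impI)
    fix i j assume "i < n" "j < nc"
    then have "A $$ (i, j) = (\<Sum>k<card S. u j (e k) * e k $ i)"
      using u sum.reindex_bij_betw[OF e, of "\<lambda>x. u j x * x $ i"] by simp
    also have "\<dots> = (\<Sum>k<d. (if k < card S then e k $ i else 0) * u j (e k))"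
      using card by (intro sum.mono_neutral_cong_left) auto
    finally show "A $$ (i, j) = (\<Sum>k<d. (if k < card S then e k $ i else 0) * u j (e k))" .
  qed
qed

lemma rank_two_lower_bound:
  assumes n: "2 \<le> n" and B: "unit_diag_offdiag_le n 2 \<epsilon> B"
  shows "cos (pi / n) \<le> \<epsilon>"
proof -
  have BC: "B \<in> carrier_mat n n" and rk: "vec_space.rank n B \<le> 2"
    and d: "\<And>i. i < n \<Longrightarrow> B $$ (i, i) = 1"
    and o: "\<And>i j. i < n \<Longrightarrow> j < n \<Longrightarrow> i \<noteq> j \<Longrightarrow> \<bar>B $$ (i, j)\<bar> \<le> \<epsilon>"
    using B by (auto simp: unit_diag_offdiag_le_def)
  obtain f g where fg: "\<And>i j. i < n \<Longrightarrow> j < n \<Longrightarrow> B $$ (i, j) = (\<Sum>k<2::nat. f i k * g k j)"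
    using vec_space.rank_factorization[OF BC rk] by metis
  have fg2: "B $$ (i, j) = f i 0 * g 0 j + f i 1 * g 1 j" if "i < n" "j < n" for i j
    using fg[OF that] by (simp add: numeral_2_eq_2)
  show ?thesis
    by (rule planar_lower_bound[of n "\<lambda>i. f i 0" "g 0" "\<lambda>i. f i 1" "g 1"])
      (use n d o in \<open>simp_all flip: fg2 del: One_nat_def\<close>)
qed

section \<open>Equally spaced lines\<close>

text \<open>The Gram matrix of the unit vectors at the angles \<open>i * (pi / n)\<close> for \<open>i < n\<close>.\<close>

definition cos_gram :: "nat \<Rightarrow> real mat" where
  "cos_gram n = mat n n (\<lambda>(i, j). cos (i * (pi / n) - j * (pi / n)))"

lemma rank_cos_gram: "vec_space.rank n (cos_gram n) \<le> 2"
proof -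
  interpret vec_space "TYPE(real)" n .
  define P where "P f = mat n n (\<lambda>(i, j). f (i * (pi / n)) * f (j * (pi / n)))"
    for f :: "real \<Rightarrow> real"
  have P: "P f \<in> carrier_mat n n" for f by (simp add: P_def)
  have "rank (P f) \<le> 1" for f
    by (rule rank_le_1_product_entries[OF P, of _ "\<lambda>i. f (i * (pi / n))" "\<lambda>i. f (i * (pi / n))"])
      (simp add: P_def)
  then have "rank (P cos) + rank (P sin) \<le> 2" by (metis add_mono one_add_one)
  moreover have "cos_gram n = P cos + P sin"
    by (rule eq_matI) (simp_all add: cos_gram_def P_def cos_diff)
  ultimately show ?thesis using rank_subadditive[OF P P, of cos sin] by simp
qed

lemma pos_semidef_cos_gram: "pos_semidef (cos_gram n)"
  unfolding pos_semidef_def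
proof (intro conjI ballI)
  show "square_mat (cos_gram n)" by (simp add: cos_gram_def)
  show "transpose_mat (cos_gram n) = cos_gram n"
  proof (rule eq_matI)
    fix i j assume "i < dim_row (cos_gram n)" "j < dim_col (cos_gram n)"
    moreover have "cos (j * (pi / n) - i * (pi / n)) = cos (i * (pi / n) - j * (pi / n))"
      by (simp add: cos_diff)
    ultimately show "transpose_mat (cos_gram n) $$ (i, j) = cos_gram n $$ (i, j)"
      by (simp add: cos_gram_def)
  qed (simp_all add: cos_gram_def)
  fix v :: "real vec" assume v: "v \<in> carrier_vec (dim_row (cos_gram n))"
  let ?x = "\<lambda>i. v $ i * cos (i * (pi / n))" and ?y = "\<lambda>i. v $ i * sin (i * (pi / n))"
  have dv: "dim_vec v = n" using v by (simp add: cos_gram_def)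
  have "v \<bullet> (cos_gram n *\<^sub>v v)
     = (\<Sum>i<n. v $ i * (\<Sum>j<n. cos (i * (pi / n) - j * (pi / n)) * v $ j))"
    using dv by (simp add: scalar_prod_def cos_gram_def lessThan_atLeast0)
  also have "\<dots> = (\<Sum>i<n. \<Sum>j<n. ?x i * ?x j + ?y i * ?y j)"
    by (simp add: sum_distrib_left cos_diff algebra_simps)
  also have "\<dots> = (\<Sum>i<n. ?x i) * (\<Sum>j<n. ?x j) + (\<Sum>i<n. ?y i) * (\<Sum>j<n. ?y j)"
    unfolding sum_product by (simp add: sum.distrib)
  finally show "0 \<le> v \<bullet> (cos_gram n *\<^sub>v v)" by simp
qed

lemma cos_gram_bound:
  fixes i j n :: nat
  assumes "i < n" "j < n" "i \<noteq> j"
  shows "\<bar>cos (i * (pi / n) - j * (pi / n))\<bar> \<le> cos (pi / n)"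
proof -
  have *: "\<bar>cos (real i * (pi / n) - real j * (pi / n))\<bar> \<le> cos (pi / n)" if "j < i" "i < n" for i j :: nat
  proof -
    define k where "k = i - j"
    have k: "1 \<le> k" "k + 1 \<le> n" "real i * (pi / n) - real j * (pi / n) = k * (pi / n)"
      using that by (auto simp: k_def of_nat_diff algebra_simps)
    have n: "0 < real n" using that by simp
    have lo: "pi / n \<le> k * (pi / n)" using k(1) by (simp add: divide_right_mono)
    have "(real k + 1) * (pi / n) \<le> n * (pi / n)" using k(2) by (intro mult_right_mono) auto
    then have hi: "k * (pi / n) \<le> pi - pi / n" using n by (simp add: distrib_right add_divide_distrib)
    have p: "0 \<le> pi / n" by simp
    have "cos (k * (pi / n)) \<le> cos (pi / n)" by (rule cos_monotone_0_pi_le) (use lo hi p in linarith)+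
    moreover have "cos (pi - pi / n) \<le> cos (k * (pi / n))"
      by (rule cos_monotone_0_pi_le) (use lo hi p in linarith)+
    then have "- cos (pi / n) \<le> cos (k * (pi / n))" by simp
    ultimately show ?thesis unfolding k(3) by linarith
  qed
  show ?thesis
  proof (cases "j < i")
    case True
    then show ?thesis using * assms by blast
  next
    case False
    then have "\<bar>cos (j * (pi / n) - i * (pi / n))\<bar> \<le> cos (pi / n)" using * assms by simp
    then show ?thesis by (metis cos_minus minus_diff_eq)
  qed
qed

lemma unit_diag_offdiag_cos_gram: "unit_diag_offdiag_le n 2 (cos (pi / n)) (cos_gram n)"
  unfolding unit_diag_offdiag_le_def
  using rank_cos_gram[of n] cos_gram_bound[of _ n] by (auto simp: cos_gram_def)

theorem theorem5:
  fixes n :: nat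
  assumes "n \<ge> 2"
  shows "off n 2 = theta n 2 \<and> theta n 2 = cos (pi / real n)"
proof -
  have "pi / n \<le> pi / 2" using assms by (intro divide_left_mono) auto
  then have c: "0 \<le> cos (pi / n)" by (intro cos_ge_zero) (auto intro: order_trans[of _ 0])
  have "theta n 2 = cos (pi / n)" unfolding theta_def
    by (rule Least_equality)
      (use c unit_diag_offdiag_cos_gram pos_semidef_cos_gram rank_two_lower_bound[OF assms] in blast)+
  moreover have "off n 2 = cos (pi / n)" unfolding off_def
    by (rule Least_equality)
      (use c unit_diag_offdiag_cos_gram rank_two_lower_bound[OF assms] in blast)+
  ultimately show ?thesis by simp
qed

end
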